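(* For the decorated hypercubic lattice model described in the context (any $d\ge1$), in the subspace with electron number $N_{\rm e}=L^d$ the ground states of $H$ all have total spin $S_{\rm tot}=N_{\rm e}/2$, and the ground state space has dimension exactly $2S_{\rm tot}+1=N_{\rm e}+1$ (i.e. the ground state is unique apart from the $(2S_{\rm tot}+1)$-fold spin degeneracy).
   Context: Let $d\ge1$ and let $L\ge4$ be an even integer. Let $V=(\mathbb Z/L\mathbb Z)^d$ be the $d$-dimensional $L\times\cdots\times L$ hypercubic lattice with periodic boundary conditions, and let $B$ be the set of nearest-neighbour bonds $\{v,w\}$ ($v,w\in V$ at (periodic) Euclidean distance $1$). For each bond $\{v,w\}\in B$ introduce a new site $m(v,w)$ (the midpoint of the bond); let $M$ be the set of these midpoints and $\Lambda=V\cup M$. With fermion operators $c_{x\sigma}$, $x\in\Lambda$, $\sigma\in\{\uparrow,\downarrow\}$, satisfying the canonical anticommutation relations, vacuum $\Phi_0$, $n_{x\sigma}=c^\dagger_{x\sigma}c_{x\sigma}$ and electron number operator $\hat N_{\rm e}=\sum_x(n_{x\uparrow}+n_{x\downarrow})$, the Hamiltonian is $H=H_{\rm hop}+H_{\rm int}$ with $$H_{\rm hop}=\sum_{\sigma}\sum_{\{v,w\}\in B}t\,(c^\dagger_{v\sigma}+c^\dagger_{w\sigma}+\lambda c^\dagger_{m(v,w)\sigma})(c_{v\sigma}+c_{w\sigma}+\lambda c_{m(v,w)\sigma}),$$ $$H_{\rm int}=U\sum_{u\in V}n_{u\uparrow}n_{u\downarrow}+U'\sum_{x\in M}n_{x\uparrow}n_{x\downarrow},$$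 where $t>0$, $\lambda>0$, $U>0$, $U'>0$. Spin operators: $S^{(\alpha)}_x=\frac12\sum_{\sigma,\tau}c^\dagger_{x\sigma}p^{(\alpha)}_{\sigma\tau}c_{x\tau}$ with $p^{(1)},p^{(2)},p^{(3)}$ the Pauli matrices; $S^{(\alpha)}_{\rm tot}=\sum_{x\in\Lambda}S^{(\alpha)}_x$ and $({\bf S}_{\rm tot})^2=\sum_{\alpha=1}^3(S^{(\alpha)}_{\rm tot})^2$, whose eigenvalues are written $S_{\rm tot}(S_{\rm tot}+1)$. *)

theory Defs
  imports Complex_Main "HOL-Library.Countable" "HOL-Library.List_Lexorder" "HOL-Library.Function_Algebras"
begin

definition verts :: "nat \<Rightarrow> nat \<Rightarrow> nat list set" where
  "verts d L = {v. length v = d \<and> (\<forall>i<d. v ! i < L)}"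

text \<open>Periodic Euclidean distance 1 on the torus: the two points differ in exactly one
  coordinate, and there by +1 or -1 modulo L.\<close>
definition step :: "nat \<Rightarrow> nat \<Rightarrow> nat list \<Rightarrow> nat list \<Rightarrow> bool" where
  "step d L v w \<longleftrightarrow> (\<exists>i<d. w ! i = (v ! i + 1) mod L \<and> (\<forall>j<d. j \<noteq> i \<longrightarrow> w ! j = v ! j))"

definition adjacent :: "nat \<Rightarrow> nat \<Rightarrow> nat list \<Rightarrow> nat list \<Rightarrow> bool" where
  "adjacent d L v w \<longleftrightarrow> v \<in> verts d L \<and> w \<in> verts d L \<and> (step d L v w \<or> step d L w v)"

definition bonds :: "nat \<Rightarrow> nat \<Rightarrow> nat list set set" where
  "bonds d L = {{v, w} | v w. adjacent d L v w}"

datatype site = Vtx "nat list" | Mid "nat list" "nat list"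

instance site :: countable by countable_datatype

definition midpt :: "nat list \<Rightarrow> nat list \<Rightarrow> site" where
  "midpt v w = Mid (min v w) (max v w)"

definition bond_mid :: "nat list set \<Rightarrow> site" where
  "bond_mid b = midpt (Min b) (Max b)"

definition mids :: "nat \<Rightarrow> nat \<Rightarrow> site set" where
  "mids d L = bond_mid ` bonds d L"

definition sites :: "nat \<Rightarrow> nat \<Rightarrow> site set" where
  "sites d L = Vtx ` verts d L \<union> mids d L"

text \<open>A mode is (site, spin), spin True = up, False = down. A state is a coefficient function
  on occupation sets (finite sets of modes); the basis vector for S is
  c^dag_{m1} ... c^dag_{mk} Phi_0 with m1 < ... < mk in the order given by to_nat.\<close>
type_synonym mode = "site \<times> bool"
type_synonym state = "mode set \<Rightarrow> complex"

definition modes :: "nat \<Rightarrow> nat \<Rightarrow> mode set" where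
  "modes d L = sites d L \<times> UNIV"

definition fsign :: "mode \<Rightarrow> mode set \<Rightarrow> complex" where
  "fsign m T = (-1) ^ card {m' \<in> T. to_nat m' < to_nat m}"

definition cr :: "mode \<Rightarrow> state \<Rightarrow> state" where
  "cr m \<psi> = (\<lambda>S. if m \<in> S then fsign m (S - {m}) * \<psi> (S - {m}) else 0)"

definition an :: "mode \<Rightarrow> state \<Rightarrow> state" where
  "an m \<psi> = (\<lambda>S. if m \<notin> S then fsign m S * \<psi> (insert m S) else 0)"

definition vacuum :: state where
  "vacuum = (\<lambda>S. if S = {} then 1 else 0)"

definition sc :: "complex \<Rightarrow> state \<Rightarrow> state" where
  "sc c \<psi> = (\<lambda>S. c * \<psi> S)"

definition addst :: "state \<Rightarrow> state \<Rightarrow> state" where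
  "addst \<phi> \<psi> = (\<lambda>S. \<phi> S + \<psi> S)"

definition opsum :: "'i set \<Rightarrow> ('i \<Rightarrow> state) \<Rightarrow> state" where
  "opsum A F = (\<lambda>S. \<Sum>a\<in>A. F a S)"

definition fock :: "nat \<Rightarrow> nat \<Rightarrow> state set" where
  "fock d L = {\<psi>. \<forall>S. \<psi> S \<noteq> 0 \<longrightarrow> S \<subseteq> modes d L}"

definition numop :: "mode \<Rightarrow> state \<Rightarrow> state" where
  "numop m \<psi> = cr m (an m \<psi>)"

definition Nop :: "nat \<Rightarrow> nat \<Rightarrow> state \<Rightarrow> state" where
  "Nop d L \<psi> = opsum (modes d L) (\<lambda>m. numop m \<psi>)"

definition bond_an :: "real \<Rightarrow> nat list set \<Rightarrow> bool \<Rightarrow> state \<Rightarrow> state" where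
  "bond_an lam b \<sigma> \<psi> = addst (addst (an (Vtx (Min b), \<sigma>) \<psi>) (an (Vtx (Max b), \<sigma>) \<psi>))
                          (sc (of_real lam) (an (bond_mid b, \<sigma>) \<psi>))"

definition bond_cr :: "real \<Rightarrow> nat list set \<Rightarrow> bool \<Rightarrow> state \<Rightarrow> state" where
  "bond_cr lam b \<sigma> \<psi> = addst (addst (cr (Vtx (Min b), \<sigma>) \<psi>) (cr (Vtx (Max b), \<sigma>) \<psi>))
                          (sc (of_real lam) (cr (bond_mid b, \<sigma>) \<psi>))"

definition Hhop :: "nat \<Rightarrow> nat \<Rightarrow> real \<Rightarrow> real \<Rightarrow> state \<Rightarrow> state" where
  "Hhop d L t lam \<psi> = opsum (UNIV :: bool set) (\<lambda>\<sigma>. opsum (bonds d L)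
      (\<lambda>b. sc (of_real t) (bond_cr lam b \<sigma> (bond_an lam b \<sigma> \<psi>))))"

definition Hint :: "nat \<Rightarrow> nat \<Rightarrow> real \<Rightarrow> real \<Rightarrow> state \<Rightarrow> state" where
  "Hint d L U U' \<psi> = addst
      (sc (of_real U) (opsum (Vtx ` verts d L) (\<lambda>x. numop (x, True) (numop (x, False) \<psi>))))
      (sc (of_real U') (opsum (mids d L) (\<lambda>x. numop (x, True) (numop (x, False) \<psi>))))"

definition Ham :: "nat \<Rightarrow> nat \<Rightarrow> real \<Rightarrow> real \<Rightarrow> real \<Rightarrow> real \<Rightarrow> state \<Rightarrow> state" where
  "Ham d L t lam U U' \<psi> = addst (Hhop d L t lam \<psi>) (Hint d L U U' \<psi>)"

text \<open>Pauli matrices, index True = up (first row/column).\<close>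
definition pauli :: "nat \<Rightarrow> bool \<Rightarrow> bool \<Rightarrow> complex" where
  "pauli \<alpha> \<sigma> \<tau> =
     (if \<alpha> = 1 then (if \<sigma> \<noteq> \<tau> then 1 else 0)
      else if \<alpha> = 2 then (if \<sigma> = \<tau> then 0 else if \<sigma> then - \<i> else \<i>)
      else (if \<sigma> = \<tau> then (if \<sigma> then 1 else -1) else 0))"

definition spin_site :: "nat \<Rightarrow> site \<Rightarrow> state \<Rightarrow> state" where
  "spin_site \<alpha> x \<psi> = sc (1/2) (opsum (UNIV :: (bool \<times> bool) set)
      (\<lambda>(\<sigma>, \<tau>). sc (pauli \<alpha> \<sigma> \<tau>) (cr (x, \<sigma>) (an (x, \<tau>) \<psi>))))"

definition spin_tot :: "nat \<Rightarrow> nat \<Rightarrow> nat \<Rightarrow> state \<Rightarrow> state" where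
  "spin_tot d L \<alpha> \<psi> = opsum (sites d L) (\<lambda>x. spin_site \<alpha> x \<psi>)"

definition spin_sq :: "nat \<Rightarrow> nat \<Rightarrow> state \<Rightarrow> state" where
  "spin_sq d L \<psi> = opsum {1, 2, 3} (\<lambda>\<alpha>. spin_tot d L \<alpha> (spin_tot d L \<alpha> \<psi>))"

definition sector :: "nat \<Rightarrow> nat \<Rightarrow> nat \<Rightarrow> state set" where
  "sector d L N = {\<psi> \<in> fock d L. Nop d L \<psi> = sc (of_nat N) \<psi>}"

definition energies :: "nat \<Rightarrow> nat \<Rightarrow> real \<Rightarrow> real \<Rightarrow> real \<Rightarrow> real \<Rightarrow> nat \<Rightarrow> real set" where
  "energies d L t lam U U' N =
     {E. \<exists>\<psi> \<in> sector d L N. \<psi> \<noteq> (\<lambda>_. 0) \<and> Ham d L t lam U U' \<psi> = sc (of_real E) \<psi>}"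

definition ground_energy :: "nat \<Rightarrow> nat \<Rightarrow> real \<Rightarrow> real \<Rightarrow> real \<Rightarrow> real \<Rightarrow> nat \<Rightarrow> real" where
  "ground_energy d L t lam U U' N = Min (energies d L t lam U U' N)"

definition ground_space :: "nat \<Rightarrow> nat \<Rightarrow> real \<Rightarrow> real \<Rightarrow> real \<Rightarrow> real \<Rightarrow> nat \<Rightarrow> state set" where
  "ground_space d L t lam U U' N =
     {\<psi> \<in> sector d L N. Ham d L t lam U U' \<psi> = sc (of_real (ground_energy d L t lam U U' N)) \<psi>}"

definition cdim :: "state set \<Rightarrow> nat" where
  "cdim A = vector_space.dim (\<lambda>(c::complex) (\<psi>::state) S. c * \<psi> S) A"

end

theory Submission
  imports Defs "HOL-Combinatorics.Transposition" "HOL-Library.FuncSet"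
begin

text \<open>
  The Hamiltonian is a sum of operators of the form \<open>c A\<^sup>\<dagger> A\<close> with \<open>c > 0\<close>, so a state has energy \<open>0\<close> iff
  every bond operator annihilates it and no site is doubly occupied. Filling each localized
  zero-energy orbital once, with all spins in the first coordinate direction, gives such a state \<open>G\<close>.

  Conversely, the bond conditions express the amplitudes of a zero-energy state with electrons on
  midpoints through those with electrons on vertices only; with \<open>L ^ d\<close> electrons and no double
  occupancy the latter are spin configurations on the vertices. The absence of double occupancy on
  the midpoint of a bond makes the ratio to \<open>G\<close> invariant under exchanging neighbouring spins, so
  by connectedness the ratio depends only on the number of down spins. Hence the ground states are
  exactly the states \<open>f (downs S) * G S\<close>. Since \<open>an (x, True) G = an (x, False) G\<close>,
  the spin operators act on such states through \<open>f\<close> alone, in the representation of spin \<open>L ^ d / 2\<close>.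
\<close>

section \<open>States and fermion operators\<close>

interpretation state_space: vector_space sc
  by unfold_locales (auto simp: sc_def algebra_simps)

lemma cdim_eq_dim: "cdim = state_space.dim"
  by (simp add: cdim_def [abs_def] sc_def [abs_def])

lemma sc_apply [simp]: "sc c \<psi> S = c * \<psi> S"
  by (simp add: sc_def)

lemma addst_eq_plus: "addst \<phi> \<psi> = \<phi> + \<psi>"
  by (simp add: addst_def fun_eq_iff)

lemma sum_state_apply [simp]: "(\<Sum>a\<in>A. F a) S = (\<Sum>a\<in>A. (F a :: state) S)"
  by (induction A rule: infinite_finite_induct) auto

lemma opsum_eq_sum: "opsum A F = (\<Sum>a\<in>A. F a)"
  by (simp add: opsum_def fun_eq_iff)

interpretation an: Vector_Spaces.linear sc sc "an m" for m
  by unfold_locales (auto simp: an_def fun_eq_iff algebra_simps)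

interpretation cr: Vector_Spaces.linear sc sc "cr m" for m
  by unfold_locales (auto simp: cr_def fun_eq_iff algebra_simps)

lemma fsign_insert:
  assumes "a \<notin> T"
  shows "fsign m (insert a T) = (if to_nat a < to_nat m then - fsign m T else fsign m T)"
proof -
  let ?below = "\<lambda>T. {m' \<in> T. to_nat m' < to_nat m}"
  have "finite (to_nat -` {..<to_nat m} :: mode set)"
    by (rule finite_vimageI) auto
  then have "finite (?below T)"
    by (rule rev_finite_subset) auto
  moreover have "?below (insert a T) = (if to_nat a < to_nat m then insert a (?below T) else ?below T)"
    by auto
  ultimately show ?thesis
    using assms by (simp add: fsign_def)
qed

lemma fsign_nonzero [simp]: "fsign m T \<noteq> 0"
  by (simp add: fsign_def)

lemma cnj_fsign [simp]: "cnj (fsign m T) = fsign m T"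
  by (simp add: fsign_def)

lemma fsign_mult_self [simp]: "fsign m T * fsign m T = 1"
  by (simp add: fsign_def flip: power_add mult_2)

lemma an_an_self [simp]: "an m (an m \<psi>) = 0"
  by (simp add: an_def fun_eq_iff)

lemma an_an_anticommute: "an m (an m' \<psi>) = - an m' (an m \<psi>)"
proof
  fix S
  show "an m (an m' \<psi>) S = (- an m' (an m \<psi>)) S"
  proof (cases "m = m' \<or> m \<in> S \<or> m' \<in> S")
    case True
    then show ?thesis by (auto simp: an_def)
  next
    case False
    then have "to_nat m \<noteq> to_nat m'" by simp
    with False show ?thesis by (auto simp: an_def fsign_insert insert_commute)
  qed
qed

lemma an_cr_anticommute: "an m (cr m' \<psi>) = (if m = m' then \<psi> else 0) - cr m' (an m \<psi>)"
proof
  fix S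
  show "an m (cr m' \<psi>) S = ((if m = m' then \<psi> else 0) - cr m' (an m \<psi>)) S"
  proof (cases "m \<noteq> m' \<and> m \<notin> S \<and> m' \<in> S")
    case True
    then obtain T where S_eq: "S = insert m' T" "m' \<notin> T"
      by (blast dest: mk_disjoint_insert)
    moreover have "insert m (insert m' T) - {m'} = insert m T"
      using True S_eq by auto
    moreover have "to_nat m \<noteq> to_nat m'"
      using True by simp
    ultimately show ?thesis
      using True by (auto simp: an_def cr_def fsign_insert)
  next
    case False
    then show ?thesis by (auto simp: an_def cr_def insert_absorb)
  qed
qed

lemma numop_apply: "numop m \<psi> S = (if m \<in> S then \<psi> S else 0)"
  by (auto simp: numop_def an_def cr_def insert_absorb)

definition pair_an :: "site \<Rightarrow> state \<Rightarrow> state" where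
  "pair_an x \<psi> = an (x, True) (an (x, False) \<psi>)"

lemma numop_numop_eq:
  "m \<noteq> m' \<Longrightarrow> numop m (numop m' \<psi>) = - cr m (cr m' (an m (an m' \<psi>)))"
  by (simp add: numop_def an_cr_anticommute cr.neg)

lemma an_an_eq_0_of_pair_an:
  assumes "pair_an x \<psi> = 0"
  shows "an (x, \<sigma>) (an (x, \<tau>) \<psi>) = 0"
  using assms an_an_anticommute [of "(x, False)" "(x, True)" \<psi>]
  by (cases \<sigma>; cases \<tau>) (simp_all add: pair_an_def)

lemma eq_0_if_doubly_occupied:
  assumes "pair_an x \<psi> = 0" "(x, True) \<in> S" "(x, False) \<in> S"
  shows "\<psi> S = 0"
proof -
  let ?T = "S - {(x, True), (x, False)}"
  have "insert (x, False) (insert (x, True) ?T) = S"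
    using assms(2,3) by auto
  moreover have "pair_an x \<psi> ?T = 0"
    using assms(1) by simp
  ultimately show ?thesis
    by (simp add: pair_an_def an_def)
qed

text \<open>
  Absence of double occupancy at \<open>m\<close> becomes an exchange symmetry of \<open>v\<close> and \<open>w\<close>, once both
  annihilation operators at \<open>m\<close> are eliminated.
\<close>

lemma exchange_antisymmetry:
  assumes relation: "\<And>\<sigma>. an (v, \<sigma>) \<psi> + an (w, \<sigma>) \<psi> + sc c (an (m, \<sigma>) \<psi>) = 0"
    and "pair_an v \<psi> = 0" "pair_an w \<psi> = 0" "pair_an m \<psi> = 0"
  shows "an (v, True) (an (w, False) \<psi>) + an (w, True) (an (v, False) \<psi>) = 0"
proof -
  define B where "B \<sigma> \<phi> = an (v, \<sigma>) \<phi> + an (w, \<sigma>) \<phi>" for \<sigma> \<phi>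
  have eliminate_m: "B \<sigma> \<psi> = - sc c (an (m, \<sigma>) \<psi>)" for \<sigma>
    using relation [of \<sigma>] by (simp add: B_def eq_neg_iff_add_eq_0)
  have B_linear: "B \<sigma> (- sc c \<phi>) = - sc c (B \<sigma> \<phi>)" for \<sigma> \<phi>
    by (simp add: B_def an.neg an.scale state_space.scale_right_distrib)
  have "B True (an (m, False) \<psi>) = - an (m, False) (B True \<psi>)"
    using an_an_anticommute [of "(v, True)" "(m, False)" \<psi>]
      an_an_anticommute [of "(w, True)" "(m, False)" \<psi>]
    by (simp add: B_def an.add)
  also have "\<dots> = 0"
    by (simp add: eliminate_m an.neg an.scale an_an_eq_0_of_pair_an [OF assms(4)])
  finally have "B True (B False \<psi>) = 0"
    by (simp add: eliminate_m B_linear)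
  then show ?thesis
    using assms(2,3) by (simp add: B_def an.add pair_an_def)
qed

section \<open>The Fock space inner product\<close>

definition fock_inner :: "mode set \<Rightarrow> state \<Rightarrow> state \<Rightarrow> complex" where
  "fock_inner M \<phi> \<psi> = (\<Sum>S\<in>Pow M. cnj (\<phi> S) * \<psi> S)"

definition sqnorm :: "mode set \<Rightarrow> state \<Rightarrow> real" where
  "sqnorm M \<psi> = (\<Sum>S\<in>Pow M. (cmod (\<psi> S))\<^sup>2)"

interpretation fock_inner: additive "fock_inner M \<phi>" for M \<phi>
  by unfold_locales (simp add: fock_inner_def sum.distrib algebra_simps)

lemma fock_inner_scale_right: "fock_inner M \<phi> (sc c \<psi>) = c * fock_inner M \<phi> \<psi>"
  by (simp add: fock_inner_def sum_distrib_left algebra_simps)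

lemma cnj_fock_inner: "cnj (fock_inner M \<phi> \<psi>) = fock_inner M \<psi> \<phi>"
  by (simp add: fock_inner_def mult.commute)

lemma fock_inner_add_left: "fock_inner M (\<phi> + \<chi>) \<psi> = fock_inner M \<phi> \<psi> + fock_inner M \<chi> \<psi>"
  by (simp add: fock_inner_def sum.distrib algebra_simps)

lemma fock_inner_scale_left: "fock_inner M (sc c \<phi>) \<psi> = cnj c * fock_inner M \<phi> \<psi>"
  by (simp add: fock_inner_def sum_distrib_left algebra_simps)

lemma fock_inner_minus_left: "fock_inner M (- \<phi>) \<psi> = - fock_inner M \<phi> \<psi>"
  by (simp add: fock_inner_def sum_negf)

lemma fock_inner_self: "fock_inner M \<psi> \<psi> = of_real (sqnorm M \<psi>)"
  unfolding fock_inner_def sqnorm_def of_real_sum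
  by (intro sum.cong refl) (metis complex_norm_square mult.commute)

lemma sqnorm_nonneg: "sqnorm M \<psi> \<ge> 0"
  by (simp add: sqnorm_def sum_nonneg)

lemma fock_inner_cr:
  assumes "finite M" "m \<in> M"
  shows "fock_inner M \<phi> (cr m \<psi>) = fock_inner M (an m \<phi>) \<psi>"
proof -
  have "fock_inner M \<phi> (cr m \<psi>) = (\<Sum>S\<in>{S \<in> Pow M. m \<in> S}. cnj (\<phi> S) * cr m \<psi> S)"
    unfolding fock_inner_def using assms(1) by (intro sum.mono_neutral_right) (auto simp: cr_def)
  also have "\<dots> = (\<Sum>S\<in>{S \<in> Pow M. m \<notin> S}. cnj (an m \<phi> S) * \<psi> S)"
    by (rule sum.reindex_bij_witness [of _ "insert m" "\<lambda>S. S - {m}"])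
      (use assms in \<open>auto simp: cr_def an_def insert_absorb\<close>)
  also have "\<dots> = fock_inner M (an m \<phi>) \<psi>"
    unfolding fock_inner_def using assms(1) by (intro sum.mono_neutral_left) (auto simp: an_def)
  finally show ?thesis .
qed

lemma fock_inner_numop_numop:
  assumes "finite M" "m \<in> M" "m' \<in> M" "m \<noteq> m'"
  shows "fock_inner M \<phi> (numop m (numop m' \<psi>)) = fock_inner M (an m (an m' \<phi>)) (an m (an m' \<psi>))"
proof -
  have "fock_inner M \<phi> (numop m (numop m' \<psi>)) = - fock_inner M (an m' (an m \<phi>)) (an m (an m' \<psi>))"
    using assms by (simp add: numop_numop_eq fock_inner.minus fock_inner_cr)
  also have "an m' (an m \<phi>) = - an m (an m' \<phi>)"
    by (rule an_an_anticommute)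
  finally show ?thesis
    by (simp only: fock_inner_minus_left minus_minus)
qed

section \<open>The decorated lattice\<close>

lemma finite_verts [simp]: "finite (verts d L)" and card_verts: "card (verts d L) = L ^ d"
proof -
  have verts_eq: "verts d L = {xs. set xs \<subseteq> {..<L} \<and> length xs = d}"
    by (auto simp: verts_def in_set_conv_nth subset_iff)
  show "finite (verts d L)" unfolding verts_eq by (rule finite_lists_length_eq) simp
  show "card (verts d L) = L ^ d" unfolding verts_eq by (subst card_lists_length_eq) auto
qed

lemma finite_bonds [simp]: "finite (bonds d L)"
proof -
  have "bonds d L \<subseteq> Pow (verts d L)" by (auto simp: bonds_def adjacent_def)
  then show ?thesis by (rule finite_subset) simp
qed

lemma finite_mids [simp]: "finite (mids d L)"
  by (simp add: mids_def)

lemma finite_sites [simp]: "finite (sites d L)"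
  by (simp add: sites_def)

lemma finite_modes [simp]: "finite (modes d L)"
  by (simp add: modes_def)

lemma step_irreflexive:
  assumes "L \<ge> 2" "v \<in> verts d L"
  shows "\<not> step d L v v"
proof
  assume "step d L v v"
  then obtain i where fixed: "i < d" "v ! i = (v ! i + 1) mod L" by (auto simp: step_def)
  moreover have "v ! i < L" using fixed assms by (auto simp: verts_def)
  ultimately show False using assms(1) by (cases "v ! i + 1 = L") auto
qed

lemma symp_adjacent: "symp (adjacent d L)"
  by (auto simp: symp_def adjacent_def)

lemma torus_connected:
  assumes "v \<in> verts d L" "w \<in> verts d L"
  shows "(adjacent d L)\<^sup>*\<^sup>* v w"
proof -
  have to_origin: "(adjacent d L)\<^sup>*\<^sup>* v (replicate d 0)" if "v \<in> verts d L" for v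
    using that
  proof (induction "sum_list v" arbitrary: v rule: less_induct)
    case less
    then have length: "length v = d" and in_range: "\<And>j. j < d \<Longrightarrow> v ! j < L"
      by (auto simp: verts_def)
    show ?case
    proof (cases "\<exists>i<d. v ! i > 0")
      case False
      then have "v = replicate d 0"
        using length by (auto intro!: nth_equalityI)
      then show ?thesis by simp
    next
      case True
      then obtain i where positive: "i < d" "v ! i > 0" by auto
      define u where "u = v[i := v ! i - 1]"
      have u_vertex: "u \<in> verts d L"
        using positive length in_range by (auto simp: verts_def u_def nth_list_update less_imp_diff_less)
      have "step d L u v"
        unfolding step_def using positive length in_range by (intro exI [of _ i]) (auto simp: u_def)
      then have "adjacent d L v u"
        using u_vertex less.prems by (simp add: adjacent_def)
      moreover have "sum_list u < sum_list v"
        using positive length elem_le_sum_list [of i v] by (simp add: u_def sum_list_update)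
      ultimately show ?thesis
        using less.hyps u_vertex converse_rtranclp_into_rtranclp by metis
    qed
  qed
  have "(adjacent d L)\<^sup>*\<^sup>* (replicate d 0) w"
    using sympD [OF symp_rtranclp [OF symp_adjacent] to_origin [OF assms(2)]] .
  with to_origin [OF assms(1)] show ?thesis by (rule rtranclp_trans)
qed

section \<open>Fock space and electron number\<close>

lemma fock_iff: "\<psi> \<in> fock d L \<longleftrightarrow> (\<forall>S. \<not> S \<subseteq> modes d L \<longrightarrow> \<psi> S = 0)"
  by (auto simp: fock_def)

lemma subspace_fock: "state_space.subspace (fock d L)"
  by (rule state_space.subspaceI) (auto simp: fock_iff)

lemma an_in_fock: "\<psi> \<in> fock d L \<Longrightarrow> an m \<psi> \<in> fock d L"
  by (auto simp: fock_def an_def split: if_splits)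

lemma finite_if_fock_nonzero: "\<psi> \<in> fock d L \<Longrightarrow> \<psi> S \<noteq> 0 \<Longrightarrow> finite S"
  by (rule finite_subset [OF _ finite_modes [of d L]]) (simp add: fock_def)

lemma sqnorm_eq_0_iff:
  assumes "\<psi> \<in> fock d L"
  shows "sqnorm (modes d L) \<psi> = 0 \<longleftrightarrow> \<psi> = 0"
proof
  assume "sqnorm (modes d L) \<psi> = 0"
  then have "\<forall>S\<in>Pow (modes d L). \<psi> S = 0"
    unfolding sqnorm_def by (subst (asm) sum_nonneg_eq_0_iff) auto
  then show "\<psi> = 0"
    using assms by (auto simp: fock_iff fun_eq_iff)
qed (simp add: sqnorm_def)

lemma fock_subset_span:
  "fock d L \<subseteq> state_space.span ((\<lambda>T S. of_bool (S = T)) ` Pow (modes d L))"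
proof
  let ?e = "\<lambda>T S. of_bool (S = T) :: complex"
  fix \<psi> assume in_fock: "\<psi> \<in> fock d L"
  have "\<psi> = (\<Sum>T\<in>Pow (modes d L). sc (\<psi> T) (?e T))"
  proof
    fix S
    have "(\<Sum>T\<in>Pow (modes d L). sc (\<psi> T) (?e T)) S = (\<Sum>T\<in>Pow (modes d L). if S = T then \<psi> T else 0)"
      by (auto intro: sum.cong)
    then show "\<psi> S = (\<Sum>T\<in>Pow (modes d L). sc (\<psi> T) (?e T)) S"
      using in_fock by (auto simp: fock_def)
  qed
  also have "\<dots> \<in> state_space.span (?e ` Pow (modes d L))"
    by (intro state_space.span_sum state_space.span_scale state_space.span_base) auto
  finally show "\<psi> \<in> state_space.span (?e ` Pow (modes d L))" .
qed

lemma finite_if_independent_fock: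
  assumes "state_space.independent B" "B \<subseteq> fock d L"
  shows "finite B"
  using state_space.independent_span_bound [OF _ assms(1) subset_trans [OF assms(2) fock_subset_span]]
  by simp

lemma Nop_apply: "Nop d L \<psi> S = of_nat (card (modes d L \<inter> S)) * \<psi> S"
proof -
  have "Nop d L \<psi> S = (\<Sum>m\<in>modes d L. if m \<in> S then \<psi> S else 0)"
    by (simp add: Nop_def opsum_def numop_apply)
  then show ?thesis
    by (simp add: Int_def flip: sum.inter_filter)
qed

lemma sector_iff:
  "\<psi> \<in> sector d L N \<longleftrightarrow> (\<forall>S. \<psi> S \<noteq> 0 \<longrightarrow> S \<subseteq> modes d L \<and> card S = N)"
proof -
  have "\<psi> \<in> sector d L N \<longleftrightarrow> \<psi> \<in> fock d L \<and> (\<forall>S. \<psi> S \<noteq> 0 \<longrightarrow> card (modes d L \<inter> S) = N)"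
    by (auto simp: sector_def fun_eq_iff Nop_apply)
  then show ?thesis
    by (auto simp: fock_def Int_absorb1)
qed

lemma subspace_sector: "state_space.subspace (sector d L N)"
proof -
  have "\<psi> \<in> sector d L N \<longleftrightarrow> (\<forall>S. \<not> (S \<subseteq> modes d L \<and> card S = N) \<longrightarrow> \<psi> S = 0)" for \<psi>
    by (auto simp: sector_iff)
  then show ?thesis
    by (intro state_space.subspaceI) auto
qed

section \<open>Eigenvalues of symmetric operators\<close>

lemma (in vector_space) biorthogonal_imp_independent:
  assumes add: "\<And>k x y. \<phi> k (x + y) = \<phi> k x + \<phi> k y"
    and scale: "\<And>k c x. \<phi> k (c *s x) = c * \<phi> k x"
    and biorthogonal: "\<And>j k. j \<in> K \<Longrightarrow> k \<in> K \<Longrightarrow> \<phi> k (e j) \<noteq> 0 \<longleftrightarrow> j = k"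
  shows "inj_on e K" and "independent (e ` K)"
proof -
  show "inj_on e K"
    by (rule inj_onI) (metis biorthogonal)
  show "independent (e ` K)"
    unfolding independent_explicit_finite_subsets
  proof (intro allI impI ballI)
    fix T u x
    assume dependence: "T \<subseteq> e ` K" "finite T" "(\<Sum>y\<in>T. u y *s y) = 0" and "x \<in> T"
    then obtain k where x_eq: "k \<in> K" "x = e k" by auto
    interpret \<phi>: additive "\<phi> k" by unfold_locales (rule add)
    have "0 = (\<Sum>y\<in>T. u y * \<phi> k y)"
      using dependence(3) \<phi>.sum [of "\<lambda>y. u y *s y" T] \<phi>.zero by (simp add: scale)
    also have "\<dots> = (\<Sum>y\<in>T. if y = x then u x * \<phi> k x else 0)"
    proof (intro sum.cong refl)
      fix y assume "y \<in> T"
      then obtain j where "j \<in> K" "y = e j" using dependence(1) by auto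
      then show "u y * \<phi> k y = (if y = x then u x * \<phi> k x else 0)"
        using biorthogonal x_eq by auto
    qed
    also have "\<dots> = u x * \<phi> k x"
      using dependence(2) \<open>x \<in> T\<close> by simp
    finally show "u x = 0"
      using biorthogonal [OF x_eq(1) x_eq(1)] x_eq(2) by simp
  qed
qed

lemma finite_eigenvalues_of_symmetric:
  assumes symmetric: "\<And>\<phi> \<psi>. fock_inner (modes d L) \<phi> (H \<psi>) = fock_inner (modes d L) (H \<phi>) \<psi>"
  shows "finite {E. \<exists>\<psi>\<in>fock d L. \<psi> \<noteq> 0 \<and> H \<psi> = sc (of_real E) \<psi>}" (is "finite ?E")
proof -
  obtain w where eigenvector: "\<And>E. E \<in> ?E \<Longrightarrow> w E \<in> fock d L \<and> w E \<noteq> 0 \<and> H (w E) = sc (of_real E) (w E)"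
    using bchoice [of ?E "\<lambda>E \<psi>. \<psi> \<in> fock d L \<and> \<psi> \<noteq> 0 \<and> H \<psi> = sc (of_real E) \<psi>"] by blast
  have "fock_inner (modes d L) (w E) (w E') \<noteq> 0 \<longleftrightarrow> E' = E" if "E' \<in> ?E" "E \<in> ?E" for E E'
  proof (cases "E' = E")
    case True
    then show ?thesis
      using eigenvector [OF that(2)] by (simp add: fock_inner_self sqnorm_eq_0_iff)
  next
    case False
    have "of_real E' * fock_inner (modes d L) (w E) (w E') = of_real E * fock_inner (modes d L) (w E) (w E')"
      using symmetric [of "w E" "w E'"] eigenvector [OF that(1)] eigenvector [OF that(2)]
      by (simp add: fock_inner_scale_left fock_inner_scale_right)
    with False show ?thesis by simp
  qed
  note independent = state_space.biorthogonal_imp_independent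
      [where \<phi> = "\<lambda>E. fock_inner (modes d L) (w E)", OF fock_inner.add fock_inner_scale_right this]
  have "w ` ?E \<subseteq> fock d L"
    using eigenvector by blast
  then have "finite (w ` ?E)"
    using independent(2) by (intro finite_if_independent_fock)
  then show ?thesis
    using independent(1) by (rule finite_imageD)
qed

section \<open>Positivity of the Hamiltonian\<close>

lemma bond_an_eq:
  "bond_an lam b \<sigma> \<psi> =
     an (Vtx (Min b), \<sigma>) \<psi> + an (Vtx (Max b), \<sigma>) \<psi> + sc (of_real lam) (an (bond_mid b, \<sigma>) \<psi>)"
  by (simp add: bond_an_def addst_eq_plus)

lemma bond_cr_eq:
  "bond_cr lam b \<sigma> \<psi> =
     cr (Vtx (Min b), \<sigma>) \<psi> + cr (Vtx (Max b), \<sigma>) \<psi> + sc (of_real lam) (cr (bond_mid b, \<sigma>) \<psi>)"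
  by (simp add: bond_cr_def addst_eq_plus)

interpretation bond_an: Vector_Spaces.linear sc sc "bond_an lam b \<sigma>" for lam b \<sigma>
  by unfold_locales
    (simp_all add: bond_an_eq an.add an.scale state_space.scale_right_distrib mult.commute)

definition frustration_free :: "nat \<Rightarrow> nat \<Rightarrow> real \<Rightarrow> state set" where
  "frustration_free d L lam = {\<psi> \<in> fock d L.
     (\<forall>b\<in>bonds d L. \<forall>\<sigma>. bond_an lam b \<sigma> \<psi> = 0) \<and> (\<forall>x\<in>sites d L. pair_an x \<psi> = 0)}"

lemma bond_an_in_fock: "\<psi> \<in> fock d L \<Longrightarrow> bond_an lam b \<sigma> \<psi> \<in> fock d L"
  unfolding bond_an_eq
  by (intro state_space.subspace_add state_space.subspace_scale subspace_fock an_in_fock)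

lemma pair_an_in_fock: "\<psi> \<in> fock d L \<Longrightarrow> pair_an x \<psi> \<in> fock d L"
  by (simp add: pair_an_def an_in_fock)

lemma subspace_frustration_free: "state_space.subspace (frustration_free d L lam)"
  using state_space.subspace_0 [OF subspace_fock] state_space.subspace_add [OF subspace_fock]
    state_space.subspace_scale [OF subspace_fock]
  by (auto intro!: state_space.subspaceI
      simp: frustration_free_def pair_an_def bond_an.add bond_an.scale an.add an.scale)

locale decorated_lattice =
  fixes d L :: nat and lam :: real
  assumes two_le_L: "L \<ge> 2" and lam_nonzero: "lam \<noteq> 0"
begin

lemma bondE:
  assumes "b \<in> bonds d L"
  obtains "Min b \<in> verts d L" "Max b \<in> verts d L" "Min b \<noteq> Max b" "bond_mid b = Mid (Min b) (Max b)"
proof -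
  obtain v w where b_eq: "b = {v, w}" "adjacent d L v w"
    using assms by (auto simp: bonds_def)
  then have "v \<noteq> w" "v \<in> verts d L" "w \<in> verts d L"
    using step_irreflexive [OF two_le_L] by (auto simp: adjacent_def)
  then show ?thesis
    using b_eq(1) by (intro that) (auto simp: bond_mid_def midpt_def min_def max_def)
qed

lemma bond_sites:
  assumes "b \<in> bonds d L"
  shows "Vtx (Min b) \<in> sites d L" "Vtx (Max b) \<in> sites d L" "bond_mid b \<in> sites d L"
  using assms by (auto elim!: bondE simp: sites_def mids_def)

abbreviation inner :: "state \<Rightarrow> state \<Rightarrow> complex" where
  "inner \<equiv> fock_inner (modes d L)"

abbreviation norm2 :: "state \<Rightarrow> real" where
  "norm2 \<equiv> sqnorm (modes d L)"

lemma inner_bond_cr: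
  assumes "b \<in> bonds d L"
  shows "inner \<phi> (bond_cr lam b \<sigma> \<psi>) = inner (bond_an lam b \<sigma> \<phi>) \<psi>"
  using bond_sites [OF assms]
  by (simp add: bond_cr_eq bond_an_eq fock_inner.add fock_inner_scale_right
      fock_inner_add_left fock_inner_scale_left fock_inner_cr modes_def)

lemma inner_double_occupancy:
  assumes "x \<in> sites d L"
  shows "inner \<phi> (numop (x, True) (numop (x, False) \<psi>)) = inner (pair_an x \<phi>) (pair_an x \<psi>)"
  using assms by (simp add: fock_inner_numop_numop pair_an_def modes_def)

end

locale flat_band_hubbard = decorated_lattice d L lam for d L lam +
  fixes t U U' :: real
  assumes couplings_pos: "t > 0" "U > 0" "U' > 0"
begin

abbreviation H :: "state \<Rightarrow> state" where
  "H \<equiv> Ham d L t lam U U'"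

lemma H_eq:
  "H \<psi> = sc (of_real t) (\<Sum>\<sigma>\<in>UNIV. \<Sum>b\<in>bonds d L. bond_cr lam b \<sigma> (bond_an lam b \<sigma> \<psi>))
       + sc (of_real U) (\<Sum>x\<in>Vtx ` verts d L. numop (x, True) (numop (x, False) \<psi>))
       + sc (of_real U') (\<Sum>x\<in>mids d L. numop (x, True) (numop (x, False) \<psi>))"
  by (simp add: Ham_def Hhop_def Hint_def addst_eq_plus opsum_eq_sum state_space.scale_sum_right add.assoc)

lemma inner_H:
  "inner \<phi> (H \<psi>) = of_real t * (\<Sum>\<sigma>\<in>UNIV. \<Sum>b\<in>bonds d L. inner (bond_an lam b \<sigma> \<phi>) (bond_an lam b \<sigma> \<psi>))
     + of_real U * (\<Sum>x\<in>Vtx ` verts d L. inner (pair_an x \<phi>) (pair_an x \<psi>))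
     + of_real U' * (\<Sum>x\<in>mids d L. inner (pair_an x \<phi>) (pair_an x \<psi>))"
  by (simp add: H_eq fock_inner.add fock_inner_scale_right fock_inner.sum inner_bond_cr
      inner_double_occupancy sites_def)

lemma H_symmetric: "inner \<phi> (H \<psi>) = inner (H \<phi>) \<psi>"
proof -
  have "inner \<phi> (H \<psi>) = cnj (inner \<psi> (H \<phi>))"
    by (simp add: inner_H cnj_fock_inner)
  then show ?thesis
    by (simp add: cnj_fock_inner)
qed

definition energy_form :: "state \<Rightarrow> real" where
  "energy_form \<psi> = t * (\<Sum>\<sigma>\<in>UNIV. \<Sum>b\<in>bonds d L. norm2 (bond_an lam b \<sigma> \<psi>))
     + U * (\<Sum>x\<in>Vtx ` verts d L. norm2 (pair_an x \<psi>)) + U' * (\<Sum>x\<in>mids d L. norm2 (pair_an x \<psi>))"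

lemma inner_H_self: "inner \<psi> (H \<psi>) = of_real (energy_form \<psi>)"
  by (simp add: inner_H fock_inner_self energy_form_def)

lemma energy_form_terms_nonneg:
  "(\<Sum>\<sigma>\<in>UNIV. \<Sum>b\<in>bonds d L. norm2 (bond_an lam b \<sigma> \<psi>)) \<ge> 0"
  "(\<Sum>x\<in>X. norm2 (pair_an x \<psi>)) \<ge> 0"
  by (intro sum_nonneg sqnorm_nonneg)+

lemma energy_form_nonneg: "energy_form \<psi> \<ge> 0"
  using couplings_pos energy_form_terms_nonneg by (simp add: energy_form_def)

lemma energy_form_eq_0_iff:
  assumes "\<psi> \<in> fock d L"
  shows "energy_form \<psi> = 0 \<longleftrightarrow> \<psi> \<in> frustration_free d L lam"
proof -
  have "energy_form \<psi> = 0 \<longleftrightarrow>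
      (\<Sum>\<sigma>\<in>UNIV. \<Sum>b\<in>bonds d L. norm2 (bond_an lam b \<sigma> \<psi>)) = 0 \<and>
      (\<Sum>x\<in>Vtx ` verts d L. norm2 (pair_an x \<psi>)) = 0 \<and> (\<Sum>x\<in>mids d L. norm2 (pair_an x \<psi>)) = 0"
    using couplings_pos energy_form_terms_nonneg [of \<psi>]
    by (simp add: energy_form_def add_nonneg_eq_0_iff)
  also have "\<dots> \<longleftrightarrow> (\<forall>\<sigma>. \<forall>b\<in>bonds d L. norm2 (bond_an lam b \<sigma> \<psi>) = 0) \<and>
      (\<forall>x\<in>sites d L. norm2 (pair_an x \<psi>) = 0)"
    by (simp add: sum_nonneg_eq_0_iff sum_nonneg sqnorm_nonneg sites_def ball_Un)
  also have "\<dots> \<longleftrightarrow> \<psi> \<in> frustration_free d L lam"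
    using assms by (auto simp: frustration_free_def sqnorm_eq_0_iff bond_an_in_fock pair_an_in_fock)
  finally show ?thesis .
qed

lemma H_eq_0_iff:
  assumes "\<psi> \<in> fock d L"
  shows "H \<psi> = 0 \<longleftrightarrow> \<psi> \<in> frustration_free d L lam"
proof
  assume "H \<psi> = 0"
  then have "energy_form \<psi> = 0"
    using inner_H_self [of \<psi>] by (simp add: fock_inner.zero)
  then show "\<psi> \<in> frustration_free d L lam"
    using assms by (simp add: energy_form_eq_0_iff)
next
  assume free: "\<psi> \<in> frustration_free d L lam"
  have "bond_cr lam b \<sigma> (bond_an lam b \<sigma> \<psi>) = 0" if "b \<in> bonds d L" for b \<sigma>
    using free that by (simp add: frustration_free_def bond_cr_eq)
  moreover have "numop (x, True) (numop (x, False) \<psi>) = 0" if "x \<in> sites d L" for x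
    using free that by (simp add: frustration_free_def numop_numop_eq flip: pair_an_def)
  ultimately show "H \<psi> = 0"
    by (simp add: H_eq sites_def)
qed

lemma energy_nonneg:
  assumes "E \<in> energies d L t lam U U' N"
  shows "E \<ge> 0"
proof -
  obtain \<psi> where eigenvector: "\<psi> \<in> fock d L" "\<psi> \<noteq> 0" "H \<psi> = sc (of_real E) \<psi>"
    using assms by (auto simp: energies_def sector_def zero_fun_def)
  have "complex_of_real (E * norm2 \<psi>) = of_real (energy_form \<psi>)"
    using inner_H_self [of \<psi>] by (simp add: eigenvector(3) fock_inner_scale_right fock_inner_self)
  then have "E * norm2 \<psi> \<ge> 0"
    using energy_form_nonneg by (simp only: of_real_eq_iff)
  moreover have "norm2 \<psi> > 0"
    using sqnorm_nonneg [of "modes d L" \<psi>] eigenvector(1,2) sqnorm_eq_0_iff by (metis order_le_less)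
  ultimately show ?thesis
    by (simp add: zero_le_mult_iff)
qed

lemma finite_energies: "finite (energies d L t lam U U' N)"
  by (rule finite_subset [OF _ finite_eigenvalues_of_symmetric [OF H_symmetric]])
    (auto simp: energies_def sector_def zero_fun_def)

lemma ground_space_eq_frustration_free:
  assumes "\<psi>\<^sub>0 \<in> frustration_free d L lam" "\<psi>\<^sub>0 \<in> sector d L N" "\<psi>\<^sub>0 \<noteq> 0"
  shows "ground_space d L t lam U U' N = frustration_free d L lam \<inter> sector d L N"
proof -
  have zero_energy: "H \<psi> = sc (of_real 0) \<psi> \<longleftrightarrow> \<psi> \<in> frustration_free d L lam" if "\<psi> \<in> sector d L N" for \<psi>
    using H_eq_0_iff that by (simp add: sector_def)
  then have "0 \<in> energies d L t lam U U' N"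
    using assms by (auto simp: energies_def zero_fun_def)
  then have "ground_energy d L t lam U U' N = 0"
    unfolding ground_energy_def by (intro Min_eqI finite_energies energy_nonneg)
  then show ?thesis
    using zero_energy by (auto simp: ground_space_def)
qed

end

section \<open>Slater determinants\<close>

definition smeared_cr :: "mode set \<Rightarrow> (mode \<Rightarrow> complex) \<Rightarrow> state \<Rightarrow> state" where
  "smeared_cr M f \<psi> = (\<Sum>m\<in>M. sc (f m) (cr m \<psi>))"

interpretation smeared_cr: Vector_Spaces.linear sc sc "smeared_cr M f" for M f
  by unfold_locales
    (simp_all add: smeared_cr_def cr.add cr.scale state_space.scale_right_distrib sum.distrib
      state_space.scale_sum_right mult.commute)

lemma an_smeared_cr:
  assumes "finite M" "m \<in> M"
  shows "an m (smeared_cr M f \<psi>) = sc (f m) \<psi> - smeared_cr M f (an m \<psi>)"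
proof -
  have "an m (smeared_cr M f \<psi>) =
      (\<Sum>m'\<in>M. (if m = m' then sc (f m') \<psi> else 0) - sc (f m') (cr m' (an m \<psi>)))"
    unfolding smeared_cr_def an.sum
    by (intro sum.cong refl) (simp add: an.scale an_cr_anticommute state_space.scale_right_diff_distrib)
  also have "\<dots> = sc (f m) \<psi> - smeared_cr M f (an m \<psi>)"
    using assms by (simp add: sum_subtractf smeared_cr_def)
  finally show ?thesis .
qed

definition slater :: "mode set \<Rightarrow> (mode \<Rightarrow> complex) list \<Rightarrow> state" where
  "slater M fs = foldr (smeared_cr M) fs vacuum"

lemma slater_Nil [simp]: "slater M [] = vacuum"
  and slater_Cons [simp]: "slater M (f # fs) = smeared_cr M f (slater M fs)"
  by (simp_all add: slater_def)

lemma an_vacuum [simp]: "an m vacuum = 0"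
  by (simp add: an_def vacuum_def fun_eq_iff)

lemma slater_support:
  assumes "slater M fs S \<noteq> 0"
  shows "finite S \<and> S \<subseteq> M \<and> card S = length fs"
  using assms
proof (induction fs arbitrary: S)
  case Nil
  then show ?case by (simp add: vacuum_def split: if_splits)
next
  case (Cons f fs)
  then obtain m where "m \<in> M" "cr m (slater M fs) S \<noteq> 0"
    by (auto simp: smeared_cr_def elim: sum.not_neutral_contains_not_neutral)
  then have "m \<in> M" "m \<in> S" "slater M fs (S - {m}) \<noteq> 0"
    by (auto simp: cr_def split: if_splits)
  then show ?case
    using Cons.IH [of "S - {m}"] card_Suc_Diff1 [of S m] by auto
qed

lemma an_slater_cong:
  assumes "finite M" "m \<in> M" "m' \<in> M" "\<And>f. f \<in> set fs \<Longrightarrow> f m = f m'"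
  shows "an m (slater M fs) = an m' (slater M fs)"
  using assms(4) by (induction fs) (simp_all add: an_smeared_cr assms(1-3))

lemma bond_an_slater_eq_0:
  assumes "finite M" "(Vtx (Min b), \<sigma>) \<in> M" "(Vtx (Max b), \<sigma>) \<in> M" "(bond_mid b, \<sigma>) \<in> M"
    and "\<And>f. f \<in> set fs \<Longrightarrow>
      f (Vtx (Min b), \<sigma>) + f (Vtx (Max b), \<sigma>) + of_real lam * f (bond_mid b, \<sigma>) = 0"
  shows "bond_an lam b \<sigma> (slater M fs) = 0"
  using assms(5)
proof (induction fs)
  case Nil
  then show ?case by (simp add: bond_an_eq)
next
  case (Cons f fs)
  let ?\<psi> = "slater M fs"
  have "bond_an lam b \<sigma> (slater M (f # fs)) =
      sc (f (Vtx (Min b), \<sigma>) + f (Vtx (Max b), \<sigma>) + of_real lam * f (bond_mid b, \<sigma>)) ?\<psi>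
      - smeared_cr M f (bond_an lam b \<sigma> ?\<psi>)"
    using assms(1-4)
    by (simp add: bond_an_eq an_smeared_cr smeared_cr.add smeared_cr.scale
        state_space.scale_right_diff_distrib state_space.scale_left_distrib)
  also have "\<dots> = 0"
    using Cons by (simp flip: zero_fun_def)
  finally show ?case .
qed

lemma slater_dual_nonzero:
  assumes "finite M" "distinct is" "m ` set is \<subseteq> M"
    and dual: "\<And>i j. i \<in> set is \<Longrightarrow> j \<in> set is \<Longrightarrow> f i (m j) \<noteq> 0 \<longleftrightarrow> i = j"
  shows "slater M (map f is) (m ` set is) \<noteq> 0"
  using assms(2-)
proof (induction "is")
  case Nil
  then show ?case by (simp add: vacuum_def)
next
  case (Cons i "is")
  let ?\<psi> = "slater M (map f is)" and ?S = "m ` set (i # is)"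
  have dual: "f i (m i) \<noteq> 0" "\<And>j. j \<in> set is \<Longrightarrow> f i (m j) = 0"
    using Cons.prems by auto
  have "slater M (map f (i # is)) ?S = (\<Sum>m'\<in>M. if m' = m i then f i m' * cr m' ?\<psi> ?S else 0)"
    using dual by (auto simp: smeared_cr_def cr_def intro!: sum.cong)
  also have "\<dots> = f i (m i) * (fsign (m i) (?S - {m i}) * ?\<psi> (?S - {m i}))"
    using assms(1) Cons.prems(2) by (simp add: cr_def)
  also have "?S - {m i} = m ` set is"
    using dual by force
  finally show ?case
    using Cons dual(1) by simp
qed

text \<open>The zero-energy orbital of the hopping matrix localized around the vertex \<open>v\<close>.\<close>

definition orbital :: "real \<Rightarrow> nat list \<Rightarrow> mode \<Rightarrow> complex" where
  "orbital lam v m = (case fst m of Vtx u \<Rightarrow> of_bool (u = v)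
     | Mid a b \<Rightarrow> if v = a \<or> v = b then - 1 / of_real lam else 0)"

text \<open>Since an orbital has equal components in both spin directions, all spins point in the first
  coordinate direction.\<close>

definition polarized :: "nat \<Rightarrow> nat \<Rightarrow> real \<Rightarrow> state" where
  "polarized d L lam = slater (modes d L) (map (orbital lam) (sorted_list_of_set (verts d L)))"

definition spin_symmetric :: "nat \<Rightarrow> nat \<Rightarrow> state \<Rightarrow> bool" where
  "spin_symmetric d L \<psi> \<longleftrightarrow> (\<forall>x\<in>sites d L. an (x, True) \<psi> = an (x, False) \<psi>)"

lemma spin_symmetricD:
  "spin_symmetric d L \<psi> \<Longrightarrow> x \<in> sites d L \<Longrightarrow> an (x, \<sigma>) \<psi> = an (x, \<tau>) \<psi>"
  by (cases \<sigma>; cases \<tau>) (simp_all add: spin_symmetric_def)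

lemma polarized_in_sector: "polarized d L lam \<in> sector d L (L ^ d)"
  using slater_support by (auto simp: sector_iff polarized_def card_verts)

lemma spin_symmetric_polarized: "spin_symmetric d L (polarized d L lam)"
  unfolding spin_symmetric_def polarized_def
  by (intro ballI an_slater_cong) (auto simp: modes_def orbital_def)

context decorated_lattice
begin

lemma polarized_frustration_free: "polarized d L lam \<in> frustration_free d L lam"
proof -
  have "polarized d L lam \<in> fock d L"
    using polarized_in_sector by (simp add: sector_def)
  moreover have "bond_an lam b \<sigma> (polarized d L lam) = 0" if "b \<in> bonds d L" for b \<sigma>
  proof -
    have "orbital lam v (Vtx (Min b), \<sigma>) + orbital lam v (Vtx (Max b), \<sigma>)
        + of_real lam * orbital lam v (bond_mid b, \<sigma>) = 0" for v
      by (rule bondE [OF that]) (use lam_nonzero in \<open>auto simp: orbital_def\<close>)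
    then show ?thesis
      unfolding polarized_def using bond_sites [OF that]
      by (intro bond_an_slater_eq_0) (auto simp: modes_def)
  qed
  moreover have "pair_an x (polarized d L lam) = 0" if "x \<in> sites d L" for x
    unfolding pair_an_def spin_symmetricD [OF spin_symmetric_polarized that, where \<sigma> = False and \<tau> = True]
    by simp
  ultimately show ?thesis
    by (simp add: frustration_free_def)
qed

end

section \<open>Reweighting by the number of down spins\<close>

definition downs :: "mode set \<Rightarrow> nat" where
  "downs S = card {m \<in> S. \<not> snd m}"

definition reweight :: "(nat \<Rightarrow> complex) \<Rightarrow> state \<Rightarrow> state" where
  "reweight f \<psi> = (\<lambda>S. f (downs S) * \<psi> S)"

interpretation reweight: Vector_Spaces.linear sc sc "reweight f" for f
  by unfold_locales (simp_all add: reweight_def fun_eq_iff algebra_simps)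

lemma downs_insert:
  assumes "finite S" "(x, \<sigma>) \<notin> S"
  shows "downs (insert (x, \<sigma>) S) = downs S + of_bool (\<not> \<sigma>)"
proof -
  have "{m \<in> insert (x, \<sigma>) S. \<not> snd m} = (if \<sigma> then {} else {(x, \<sigma>)}) \<union> {m \<in> S. \<not> snd m}"
    by auto
  then show ?thesis
    using assms by (auto simp: downs_def)
qed

lemma reweight_in_fock: "\<psi> \<in> fock d L \<Longrightarrow> reweight f \<psi> \<in> fock d L"
  by (simp add: fock_def reweight_def)

lemma reweight_in_sector: "\<psi> \<in> sector d L N \<Longrightarrow> reweight f \<psi> \<in> sector d L N"
  by (simp add: sector_iff reweight_def)

lemma an_reweight:
  assumes "\<psi> \<in> fock d L"
  shows "an (x, \<sigma>) (reweight f \<psi>) = reweight (\<lambda>k. f (k + of_bool (\<not> \<sigma>))) (an (x, \<sigma>) \<psi>)"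
proof
  fix S
  show "an (x, \<sigma>) (reweight f \<psi>) S = reweight (\<lambda>k. f (k + of_bool (\<not> \<sigma>))) (an (x, \<sigma>) \<psi>) S"
    using finite_if_fock_nonzero [OF assms, of "insert (x, \<sigma>) S"]
    by (cases "\<psi> (insert (x, \<sigma>) S) = 0") (simp_all add: an_def reweight_def downs_insert)
qed

lemma cr_reweight:
  assumes "\<psi> \<in> fock d L"
  shows "cr (x, \<sigma>) (reweight f \<psi>) = reweight (\<lambda>k. f (k - of_bool (\<not> \<sigma>))) (cr (x, \<sigma>) \<psi>)"
proof
  fix S
  show "cr (x, \<sigma>) (reweight f \<psi>) S = reweight (\<lambda>k. f (k - of_bool (\<not> \<sigma>))) (cr (x, \<sigma>) \<psi>) S"
  proof (cases "(x, \<sigma>) \<in> S \<and> \<psi> (S - {(x, \<sigma>)}) \<noteq> 0")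
    case True
    then obtain T where S_eq: "S = insert (x, \<sigma>) T" "(x, \<sigma>) \<notin> T"
      by (blast dest: mk_disjoint_insert)
    then have "finite T"
      using True finite_if_fock_nonzero [OF assms, of T] by simp
    with S_eq show ?thesis
      by (simp add: cr_def reweight_def downs_insert)
  qed (auto simp: cr_def reweight_def)
qed

lemma reweight_frustration_free:
  assumes "\<psi> \<in> frustration_free d L lam"
  shows "reweight f \<psi> \<in> frustration_free d L lam"
proof -
  have in_fock: "\<psi> \<in> fock d L"
    using assms by (simp add: frustration_free_def)
  have "bond_an lam b \<sigma> (reweight f \<psi>) = reweight (\<lambda>k. f (k + of_bool (\<not> \<sigma>))) (bond_an lam b \<sigma> \<psi>)" for b \<sigma>
    by (simp only: bond_an_eq an_reweight [OF in_fock] reweight.add reweight.scale)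
  moreover have "pair_an x (reweight f \<psi>) = reweight (\<lambda>k. f (k + 1)) (pair_an x \<psi>)" for x
    by (simp add: pair_an_def an_reweight [OF in_fock] an_reweight [OF an_in_fock [OF in_fock]])
  ultimately show ?thesis
    using assms by (simp add: frustration_free_def reweight_in_fock)
qed

section \<open>Connected graphs\<close>

text \<open>
  Transpositions along the edges of a connected graph generate all transpositions, because
  \<open>(u w) = (u v)(v w)(u v)\<close>.
\<close>

lemma transpose_invariant_if_connected:
  assumes edge: "\<And>v w A. E v w \<Longrightarrow> h (transpose v w ` A) = h A"
    and "E\<^sup>*\<^sup>* u w"
  shows "h (transpose u w ` A) = h A"
  using \<open>E\<^sup>*\<^sup>* u w\<close>
proof (induction arbitrary: A)
  case (step v w)
  show ?case
  proof (cases "u = w \<or> v = w")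
    case True
    then show ?thesis using step.IH by auto
  next
    case False
    then have "transpose u w = transpose u v \<circ> transpose v w \<circ> transpose u v"
      by (simp add: transpose_comp_triple)
    then have "h (transpose u w ` A) = h (transpose u v ` transpose v w ` transpose u v ` A)"
      by (simp only: image_comp comp_assoc)
    then show ?thesis
      using step edge by simp
  qed
qed simp

lemma transpose_image_eq_exchange:
  assumes "v \<in> A" "w \<notin> A"
  shows "transpose v w ` A = insert w (A - {v})"
  using assms by (auto simp: in_transpose_image_iff transpose_def)

lemma transpose_invariant_imp_card_invariant:
  assumes transpose: "\<And>v w A. v \<in> V \<Longrightarrow> w \<in> V \<Longrightarrow> h (transpose v w ` A) = h A"
    and "finite V" and "A \<subseteq> V" "B \<subseteq> V" "card A = card B"
  shows "h A = h B"
  using assms(3-)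
proof (induction "card (A - B)" arbitrary: A rule: less_induct)
  case less
  have finite: "finite A" "finite B"
    using less.prems \<open>finite V\<close> by (auto intro: finite_subset)
  show ?case
  proof (cases "A = B")
    case False
    then have "\<not> A \<subseteq> B" "\<not> B \<subseteq> A"
      using finite less.prems(3) card_subset_eq by metis+
    then obtain v w where vw: "v \<in> A" "v \<notin> B" "w \<in> B" "w \<notin> A" by auto
    let ?A' = "insert w (A - {v})"
    have "?A' - B = (A - B) - {v}"
      using vw by auto
    then have "card (?A' - B) < card (A - B)"
      using vw finite card_Diff1_less [of "A - B" v] by simp
    moreover have "?A' \<subseteq> V" "card ?A' = card B"
      using less.prems vw finite card_Suc_Diff1 [of A v] by auto
    ultimately have "h ?A' = h B"
      using less.hyps less.prems(2) by blast
    moreover have "h ?A' = h A"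
      using transpose [of v w A] vw less.prems by (auto simp: transpose_image_eq_exchange)
    ultimately show ?thesis by simp
  qed simp
qed

lemma exchange_invariant_imp_card_invariant:
  assumes exchange: "\<And>v w A. E v w \<Longrightarrow> v \<in> A \<Longrightarrow> w \<notin> A \<Longrightarrow> h (insert w (A - {v})) = h A"
    and "symp E" and connected: "\<And>v w. v \<in> V \<Longrightarrow> w \<in> V \<Longrightarrow> E\<^sup>*\<^sup>* v w"
    and "finite V" "A \<subseteq> V" "B \<subseteq> V" "card A = card B"
  shows "h A = h B"
proof -
  have "h (transpose v w ` A) = h A" if "E v w" for v w A
    using exchange [of v w A] exchange [of w v A] sympD [OF \<open>symp E\<close> that] that
      transpose_image_eq_exchange [of v A w] transpose_image_eq_exchange [of w A v]
    by (cases "v \<in> A"; cases "w \<in> A") (simp_all add: transpose_commute [of w v])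
  then have "h (transpose v w ` A) = h A" if "v \<in> V" "w \<in> V" for v w A
    using transpose_invariant_if_connected [OF _ connected [OF that]] by blast
  then show ?thesis
    using assms(4-) by (rule transpose_invariant_imp_card_invariant)
qed

section \<open>Uniqueness up to the number of down spins\<close>

definition config :: "nat \<Rightarrow> nat \<Rightarrow> nat list set \<Rightarrow> mode set" where
  "config d L A = (\<lambda>v. (Vtx v, v \<in> A)) ` verts d L"

lemma polarized_config_nonzero: "polarized d L lam (config d L A) \<noteq> 0"
proof -
  have "(\<lambda>v. (Vtx v, v \<in> A)) ` verts d L \<subseteq> modes d L"
    by (auto simp: modes_def sites_def)
  moreover have "orbital lam u (Vtx v, v \<in> A) \<noteq> 0 \<longleftrightarrow> u = v" for u v
    by (auto simp: orbital_def)
  ultimately show ?thesis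
    using slater_dual_nonzero
      [of "modes d L" "sorted_list_of_set (verts d L)" "\<lambda>v. (Vtx v, v \<in> A)" "orbital lam"]
    by (simp add: polarized_def config_def)
qed

lemma downs_config:
  assumes "A \<subseteq> verts d L"
  shows "downs (config d L A) = L ^ d - card A"
proof -
  have "{m \<in> config d L A. \<not> snd m} = (\<lambda>v. (Vtx v, False)) ` (verts d L - A)"
    by (auto simp: config_def)
  then have "downs (config d L A) = card (verts d L - A)"
    by (simp add: downs_def card_image inj_on_def)
  then show ?thesis
    using assms by (simp add: card_Diff_subset finite_subset [OF assms] card_verts)
qed

definition mid_electrons :: "nat \<Rightarrow> nat \<Rightarrow> mode set \<Rightarrow> mode set" where
  "mid_electrons d L S = {m \<in> S. fst m \<in> mids d L}"

lemma mid_electrons_insert_Vtx: "mid_electrons d L (insert (Vtx v, \<sigma>) S) = mid_electrons d L S"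
  by (auto simp: mid_electrons_def mids_def bond_mid_def midpt_def)

lemma card_mid_electrons_insert_mid:
  assumes "b \<in> bonds d L" "(bond_mid b, \<sigma>) \<notin> S" "finite S"
  shows "card (mid_electrons d L (insert (bond_mid b, \<sigma>) S)) = Suc (card (mid_electrons d L S))"
proof -
  have "mid_electrons d L (insert (bond_mid b, \<sigma>) S) = insert (bond_mid b, \<sigma>) (mid_electrons d L S)"
    using assms(1) by (auto simp: mid_electrons_def mids_def)
  then show ?thesis
    using assms(2,3) by (simp add: mid_electrons_def)
qed

lemma eq_graph_if_singly_occupied:
  fixes S :: "('a \<times> bool) set"
  assumes "finite X" "S \<subseteq> X \<times> UNIV" "card S = card X"
    and single: "\<And>x. x \<in> X \<Longrightarrow> \<not> ((x, True) \<in> S \<and> (x, False) \<in> S)"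
  shows "S = (\<lambda>x. (x, (x, True) \<in> S)) ` X"
proof -
  have determined: "x \<in> X \<and> (\<sigma> \<longleftrightarrow> (x, True) \<in> S)" if "(x, \<sigma>) \<in> S" for x \<sigma>
    using single [of x] that assms(2) by (cases \<sigma>) auto
  then have "inj_on fst S"
    by (fastforce intro: inj_onI)
  then have "card (fst ` S) = card X"
    using assms(3) by (simp add: card_image)
  then have "fst ` S = X"
    using assms(1,2) by (intro card_subset_eq) auto
  then have "(x, (x, True) \<in> S) \<in> S" if "x \<in> X" for x
    using that determined by force
  then show ?thesis
    using determined by (auto intro: rev_image_eqI)
qed

context decorated_lattice
begin

lemma frustration_free_exchange:
  assumes free: "\<psi> \<in> frustration_free d L lam" and adjacent: "adjacent d L v w"
  shows "an (Vtx v, True) (an (Vtx w, False) \<psi>) + an (Vtx w, True) (an (Vtx v, False) \<psi>) = 0"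
proof -
  have bond: "{v, w} \<in> bonds d L"
    using adjacent by (auto simp: bonds_def)
  let ?v = "Vtx (Min {v, w})" and ?w = "Vtx (Max {v, w})"
  have "an (?v, True) (an (?w, False) \<psi>) + an (?w, True) (an (?v, False) \<psi>) = 0"
  proof (rule exchange_antisymmetry)
    show "an (?v, \<sigma>) \<psi> + an (?w, \<sigma>) \<psi> + sc (of_real lam) (an (bond_mid {v, w}, \<sigma>) \<psi>) = 0" for \<sigma>
      using free bond unfolding bond_an_eq [symmetric] by (simp add: frustration_free_def)
  qed (use free bond_sites [OF bond] in \<open>simp_all add: frustration_free_def\<close>)
  then show ?thesis
    by (cases "v \<le> w") (simp_all add: min_def max_def add.commute)
qed

lemma frustration_free_mid_eq_0:
  assumes "\<psi> \<in> frustration_free d L lam" "b \<in> bonds d L" "(bond_mid b, \<sigma>) \<notin> T"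
    and "\<And>v. v \<in> verts d L \<Longrightarrow> \<psi> (insert (Vtx v, \<sigma>) T) = 0"
  shows "\<psi> (insert (bond_mid b, \<sigma>) T) = 0"
proof -
  have "bond_an lam b \<sigma> \<psi> T = 0"
    using assms(1,2) by (simp add: frustration_free_def)
  moreover have "an (Vtx (Min b), \<sigma>) \<psi> T = 0" "an (Vtx (Max b), \<sigma>) \<psi> T = 0"
    by (rule bondE [OF assms(2)]; simp add: an_def assms(4))+
  ultimately show ?thesis
    using assms(3) lam_nonzero by (simp add: bond_an_eq an_def)
qed

text \<open>The bond condition moves electrons from midpoints to vertices.\<close>

lemma frustration_free_eq_0_if_vanishes_on_verts:
  assumes free: "\<psi> \<in> frustration_free d L lam"
    and vanishes: "\<And>S. S \<subseteq> Vtx ` verts d L \<times> UNIV \<Longrightarrow> \<psi> S = 0"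
  shows "\<psi> = 0"
proof -
  have "\<psi> S = 0" if "S \<subseteq> modes d L" for S
    using that
  proof (induction "card (mid_electrons d L S)" arbitrary: S rule: less_induct)
    case less
    show ?case
    proof (cases "mid_electrons d L S = {}")
      case True
      then have "S \<subseteq> Vtx ` verts d L \<times> UNIV"
        using less.prems by (auto simp: mid_electrons_def modes_def sites_def)
      then show ?thesis by (rule vanishes)
    next
      case False
      then obtain b \<sigma> where bond: "b \<in> bonds d L" and "(bond_mid b, \<sigma>) \<in> S"
        by (auto simp: mid_electrons_def mids_def)
      then obtain T where S_eq: "S = insert (bond_mid b, \<sigma>) T" "(bond_mid b, \<sigma>) \<notin> T"
        by (blast dest: mk_disjoint_insert)
      have "\<psi> (insert (Vtx v, \<sigma>) T) = 0" if "v \<in> verts d L" for v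
      proof (rule less.hyps)
        have "finite T"
          using S_eq finite_subset [OF less.prems] by simp
        then show "card (mid_electrons d L (insert (Vtx v, \<sigma>) T)) < card (mid_electrons d L S)"
          using S_eq bond by (simp add: mid_electrons_insert_Vtx card_mid_electrons_insert_mid)
        show "insert (Vtx v, \<sigma>) T \<subseteq> modes d L"
          using less.prems that S_eq by (auto simp: modes_def sites_def)
      qed
      then show ?thesis
        unfolding S_eq(1) by (rule frustration_free_mid_eq_0 [OF free bond S_eq(2)])
    qed
  qed
  then show ?thesis
    using free by (auto simp: frustration_free_def fock_iff fun_eq_iff)
qed

lemma frustration_free_eq_0_if_vanishes_on_configs:
  assumes free: "\<psi> \<in> frustration_free d L lam" and sector: "\<psi> \<in> sector d L (L ^ d)"
    and configs: "\<And>A. A \<subseteq> verts d L \<Longrightarrow> \<psi> (config d L A) = 0"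
  shows "\<psi> = 0"
proof (rule frustration_free_eq_0_if_vanishes_on_verts [OF free], rule ccontr)
  fix S
  assume occupied: "S \<subseteq> Vtx ` verts d L \<times> UNIV" "\<psi> S \<noteq> 0"
  have single: "\<not> ((x, True) \<in> S \<and> (x, False) \<in> S)" if "x \<in> Vtx ` verts d L" for x
    using eq_0_if_doubly_occupied [of x \<psi> S] free that occupied(2)
    by (auto simp: frustration_free_def sites_def)
  have "card S = card (Vtx ` verts d L)"
    using sector occupied(2) by (simp add: sector_iff card_image inj_on_def card_verts)
  then have "S = (\<lambda>x. (x, (x, True) \<in> S)) ` Vtx ` verts d L"
    using occupied(1) single by (intro eq_graph_if_singly_occupied) auto
  also have "\<dots> = config d L {v \<in> verts d L. (Vtx v, True) \<in> S}"
    by (auto simp: config_def)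
  finally show False
    using occupied(2) configs [of "{v \<in> verts d L. (Vtx v, True) \<in> S}"] by simp
qed

lemma config_exchange:
  assumes free: "\<phi> \<in> frustration_free d L lam" "\<psi> \<in> frustration_free d L lam"
    and adjacent: "adjacent d L v w" and differ: "v \<in> A" "w \<notin> A"
  defines "B \<equiv> insert w (A - {v})"
  shows "\<phi> (config d L A) * \<psi> (config d L B) = \<phi> (config d L B) * \<psi> (config d L A)"
proof -
  define T where "T = (\<lambda>v. (Vtx v, v \<in> A)) ` (verts d L - {v, w})"
  have config_A: "config d L A = insert (Vtx w, False) (insert (Vtx v, True) T)"
    and config_B: "config d L B = insert (Vtx v, False) (insert (Vtx w, True) T)"
    using adjacent differ by (auto simp: config_def T_def B_def adjacent_def image_iff)
  have T_disjoint: "(Vtx v, \<sigma>) \<notin> T" "(Vtx w, \<sigma>) \<notin> T" for \<sigma>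
    by (auto simp: T_def)
  define p where "p = fsign (Vtx v, True) T * fsign (Vtx w, False) (insert (Vtx v, True) T)"
  define q where "q = fsign (Vtx w, True) T * fsign (Vtx v, False) (insert (Vtx w, True) T)"
  have relation: "p * \<chi> (config d L A) + q * \<chi> (config d L B) = 0" if "\<chi> \<in> frustration_free d L lam" for \<chi>
    using fun_cong [OF frustration_free_exchange [OF that adjacent], of T] T_disjoint differ
    by (auto simp: an_def config_A config_B p_def q_def mult.assoc)
  have "p * (\<phi> (config d L A) * \<psi> (config d L B)) = p * (\<phi> (config d L B) * \<psi> (config d L A))"
    using relation [OF free(1)] relation [OF free(2)] by algebra
  moreover have "p \<noteq> 0"
    by (simp add: p_def)
  ultimately show ?thesis by simp
qed

lemma config_ratio_depends_on_downs:
  assumes "\<psi> \<in> frustration_free d L lam"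
  obtains f where "\<And>A. A \<subseteq> verts d L \<Longrightarrow>
    \<psi> (config d L A) = f (downs (config d L A)) * polarized d L lam (config d L A)"
proof -
  define h where "h A = \<psi> (config d L A) / polarized d L lam (config d L A)" for A
  have "h (insert w (A - {v})) = h A" if "adjacent d L v w" "v \<in> A" "w \<notin> A" for v w A
    using config_exchange [OF assms polarized_frustration_free that]
    by (simp add: h_def frac_eq_eq polarized_config_nonzero)
  note card_invariant = exchange_invariant_imp_card_invariant
    [OF this symp_adjacent torus_connected finite_verts]
  have "h A = h B" if "A \<subseteq> verts d L" "B \<subseteq> verts d L" "downs (config d L A) = downs (config d L B)" for A B
  proof -
    have "card A \<le> L ^ d" "card B \<le> L ^ d"
      using that card_mono [OF finite_verts] by (metis card_verts)+
    then have "card A = card B"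
      using that by (simp add: downs_config)
    with that show ?thesis
      using card_invariant by blast
  qed
  then obtain f where "\<And>A. A \<subseteq> verts d L \<Longrightarrow> h A = f (downs (config d L A))"
    using function_factors_left_gen [of "\<lambda>A. A \<subseteq> verts d L" "\<lambda>A. downs (config d L A)" h] by blast
  then show ?thesis
    by (intro that [of f]) (simp add: h_def field_simps polarized_config_nonzero)
qed

lemma frustration_free_sector_eq:
  "frustration_free d L lam \<inter> sector d L (L ^ d) = range (\<lambda>f. reweight f (polarized d L lam))"
proof (intro equalityI subsetI)
  fix \<psi>
  assume free: "\<psi> \<in> frustration_free d L lam \<inter> sector d L (L ^ d)"
  then obtain f where configs: "\<And>A. A \<subseteq> verts d L \<Longrightarrow>
      \<psi> (config d L A) = f (downs (config d L A)) * polarized d L lam (config d L A)"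
    using config_ratio_depends_on_downs by blast
  have "\<psi> - reweight f (polarized d L lam) = 0"
  proof (rule frustration_free_eq_0_if_vanishes_on_configs)
    show "\<psi> - reweight f (polarized d L lam) \<in> frustration_free d L lam"
      using free by (intro state_space.subspace_diff subspace_frustration_free
          reweight_frustration_free polarized_frustration_free) simp
    show "\<psi> - reweight f (polarized d L lam) \<in> sector d L (L ^ d)"
      using free reweight_in_sector [OF polarized_in_sector]
      by (intro state_space.subspace_diff subspace_sector) auto
  qed (simp add: configs reweight_def)
  then show "\<psi> \<in> range (\<lambda>f. reweight f (polarized d L lam))"
    by simp
qed (auto intro: reweight_frustration_free polarized_frustration_free
    reweight_in_sector polarized_in_sector)

end

section \<open>Total spin\<close>

text \<open>The action of a spin component on \<open>reweight f \<psi>\<close> as an operator on \<open>f\<close>, for a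
  spin-symmetric state \<open>\<psi>\<close> of \<open>n\<close> electrons; the factor \<open>k\<close> makes the value of \<open>f (k - 1)\<close> at
  \<open>k = 0\<close> irrelevant.\<close>

definition spin_action :: "nat \<Rightarrow> nat \<Rightarrow> (nat \<Rightarrow> complex) \<Rightarrow> nat \<Rightarrow> complex" where
  "spin_action n \<alpha> f k = 1/2 *
     ((of_nat n - of_nat k) * (pauli \<alpha> True True * f k + pauli \<alpha> True False * f (k + 1))
      + of_nat k * (pauli \<alpha> False True * f (k - 1) + pauli \<alpha> False False * f k))"

lemma spin_action_casimir:
  "(\<Sum>\<alpha>\<in>{1, 2, 3}. spin_action n \<alpha> (spin_action n \<alpha> f) k)
     = of_real ((real n / 2) * (real n / 2 + 1)) * f k"
proof (cases k)
  case 0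
  then show ?thesis by (simp add: spin_action_def pauli_def field_simps)
next
  case (Suc j)
  then show ?thesis by (cases j) (simp_all add: spin_action_def pauli_def field_simps)
qed

lemma sum_numop_down:
  assumes "\<psi> \<in> fock d L"
  shows "(\<Sum>x\<in>sites d L. numop (x, False) \<psi>) = reweight of_nat \<psi>"
proof
  fix S
  have "(\<Sum>x\<in>sites d L. numop (x, False) \<psi>) S = of_nat (card {x \<in> sites d L. (x, False) \<in> S}) * \<psi> S"
    by (simp add: numop_apply flip: sum.inter_filter)
  moreover have "card {x \<in> sites d L. (x, False) \<in> S} = downs S" if "\<psi> S \<noteq> 0"
  proof -
    have "{m \<in> S. \<not> snd m} = (\<lambda>x. (x, False)) ` {x \<in> sites d L. (x, False) \<in> S}"
      using assms that by (force simp: fock_def modes_def)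
    then show ?thesis
      by (simp add: downs_def card_image inj_on_def)
  qed
  ultimately show "(\<Sum>x\<in>sites d L. numop (x, False) \<psi>) S = reweight of_nat \<psi> S"
    by (cases "\<psi> S = 0") (simp_all add: reweight_def)
qed

lemma sum_numop_up:
  assumes "\<psi> \<in> sector d L n"
  shows "(\<Sum>x\<in>sites d L. numop (x, True) \<psi>) = reweight (\<lambda>k. of_nat n - of_nat k) \<psi>"
proof -
  have "sc (of_nat n) \<psi> = (\<Sum>m\<in>sites d L \<times> UNIV. numop m \<psi>)"
    using assms by (simp add: sector_def Nop_def opsum_eq_sum modes_def)
  also have "\<dots> = (\<Sum>x\<in>sites d L. \<Sum>\<sigma>\<in>UNIV. numop (x, \<sigma>) \<psi>)"
    by (simp add: sum.cartesian_product)
  also have "\<dots> = (\<Sum>x\<in>sites d L. numop (x, True) \<psi>) + (\<Sum>x\<in>sites d L. numop (x, False) \<psi>)"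
    by (simp add: UNIV_bool sum.distrib add.commute)
  also have "(\<Sum>x\<in>sites d L. numop (x, False) \<psi>) = reweight of_nat \<psi>"
    using assms by (intro sum_numop_down) (simp add: sector_def)
  finally have "(\<Sum>x\<in>sites d L. numop (x, True) \<psi>) = sc (of_nat n) \<psi> - reweight of_nat \<psi>"
    by (simp only: eq_diff_eq)
  then show ?thesis
    by (simp add: fun_eq_iff reweight_def algebra_simps)
qed

lemma cr_an_reweight:
  assumes "\<psi> \<in> fock d L" "spin_symmetric d L \<psi>" "x \<in> sites d L"
  shows "cr (x, \<sigma>) (an (x, \<tau>) (reweight f \<psi>)) =
    reweight (\<lambda>k. f (k - of_bool (\<not> \<sigma>) + of_bool (\<not> \<tau>))) (numop (x, \<sigma>) \<psi>)"
  using spin_symmetricD [OF assms(2,3), of \<tau> \<sigma>]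
  by (simp add: an_reweight [OF assms(1)] cr_reweight [OF an_in_fock [OF assms(1)]] numop_def)

lemma spin_tot_reweight:
  assumes sector: "\<psi> \<in> sector d L n" and symmetric: "spin_symmetric d L \<psi>"
  shows "spin_tot d L \<alpha> (reweight f \<psi>) = reweight (spin_action n \<alpha> f) \<psi>"
proof -
  have in_fock: "\<psi> \<in> fock d L"
    using sector by (simp add: sector_def)
  define f' where "f' \<sigma> \<tau> = (\<lambda>k. f (k - of_bool (\<not> \<sigma>) + of_bool (\<not> \<tau>)))" for \<sigma> \<tau>
  define N where "N \<sigma> = (\<Sum>x\<in>sites d L. numop (x, \<sigma>) \<psi>)" for \<sigma>
  have "spin_tot d L \<alpha> (reweight f \<psi>) =
      (\<Sum>x\<in>sites d L. sc (1/2) (\<Sum>\<sigma>\<in>UNIV. \<Sum>\<tau>\<in>UNIV. sc (pauli \<alpha> \<sigma> \<tau>) (reweight (f' \<sigma> \<tau>) (numop (x, \<sigma>) \<psi>))))"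
    by (simp add: spin_tot_def spin_site_def opsum_eq_sum cr_an_reweight [OF in_fock symmetric] f'_def
        sum.cartesian_product)
  also have "\<dots> = sc (1/2) (\<Sum>\<sigma>\<in>UNIV. \<Sum>\<tau>\<in>UNIV. sc (pauli \<alpha> \<sigma> \<tau>) (reweight (f' \<sigma> \<tau>) (N \<sigma>)))"
    by (simp add: N_def UNIV_bool sum.distrib reweight.sum state_space.scale_sum_right
        state_space.scale_right_distrib)
  also have "\<dots> = reweight (spin_action n \<alpha> f) \<psi>"
  proof
    fix S
    have "N True = reweight (\<lambda>k. of_nat n - of_nat k) \<psi>" "N False = reweight of_nat \<psi>"
      by (simp_all add: N_def sum_numop_up [OF sector] sum_numop_down [OF in_fock])
    then show "sc (1/2) (\<Sum>\<sigma>\<in>UNIV. \<Sum>\<tau>\<in>UNIV. sc (pauli \<alpha> \<sigma> \<tau>) (reweight (f' \<sigma> \<tau>) (N \<sigma>))) S =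
        reweight (spin_action n \<alpha> f) \<psi> S"
      by (cases "downs S")
        (simp_all add: UNIV_bool f'_def reweight_def spin_action_def field_simps)
  qed
  finally show ?thesis .
qed

lemma spin_sq_reweight:
  assumes "\<psi> \<in> sector d L n" "spin_symmetric d L \<psi>"
  shows "spin_sq d L (reweight f \<psi>) = sc (of_real ((real n / 2) * (real n / 2 + 1))) (reweight f \<psi>)"
proof
  fix S
  have "spin_sq d L (reweight f \<psi>) S =
      (\<Sum>\<alpha>\<in>{1, 2, 3}. spin_action n \<alpha> (spin_action n \<alpha> f) (downs S)) * \<psi> S"
    unfolding spin_sq_def opsum_def spin_tot_reweight [OF assms] sum_distrib_right
    by (simp add: reweight_def)
  then show "spin_sq d L (reweight f \<psi>) S =
      sc (of_real ((real n / 2) * (real n / 2 + 1))) (reweight f \<psi>) S"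
    unfolding spin_action_casimir by (simp add: reweight_def mult.assoc)
qed

section \<open>Dimension of the ground state space\<close>

lemma reweight_eq_sum:
  assumes "\<psi> \<in> sector d L n"
  shows "reweight f \<psi> = (\<Sum>k\<le>n. sc (f k) (reweight (\<lambda>j. of_bool (j = k)) \<psi>))"
proof
  fix S
  have "downs S \<le> n" if "\<psi> S \<noteq> 0"
  proof -
    have "finite S" "card S = n"
      using assms that finite_subset [OF _ finite_modes] by (auto simp: sector_iff)
    then show ?thesis
      unfolding downs_def by (auto intro: card_mono)
  qed
  then show "reweight f \<psi> S = (\<Sum>k\<le>n. sc (f k) (reweight (\<lambda>j. of_bool (j = k)) \<psi>)) S"
    by (cases "\<psi> S = 0") (simp_all add: reweight_def of_bool_def if_distrib if_distribR cong: if_cong)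
qed

lemma cdim_reweight:
  assumes sector: "\<psi> \<in> sector d L n"
    and nonzero: "\<And>k. k \<le> n \<Longrightarrow> \<exists>S. downs S = k \<and> \<psi> S \<noteq> 0"
  shows "cdim (range (\<lambda>f. reweight f \<psi>)) = n + 1"
proof -
  define e where "e k = reweight (\<lambda>j. of_bool (j = k)) \<psi>" for k
  obtain s where witness: "\<And>k. k \<le> n \<Longrightarrow> downs (s k) = k" "\<And>k. k \<le> n \<Longrightarrow> \<psi> (s k) \<noteq> 0"
    using nonzero by metis
  have biorthogonal: "e j (s k) \<noteq> 0 \<longleftrightarrow> j = k" if "j \<in> {..n}" "k \<in> {..n}" for j k
    using witness [of k] that by (auto simp: e_def reweight_def)
  have inj: "inj_on e {..n}" and independent: "state_space.independent (e ` {..n})"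
    by (rule state_space.biorthogonal_imp_independent [where \<phi> = "\<lambda>k \<chi>. \<chi> (s k)"];
        simp add: biorthogonal)+
  have "state_space.dim (range (\<lambda>f. reweight f \<psi>)) = n + 1"
  proof (rule state_space.dim_unique)
    show "e ` {..n} \<subseteq> range (\<lambda>f. reweight f \<psi>)"
      by (auto simp: e_def)
    show "range (\<lambda>f. reweight f \<psi>) \<subseteq> state_space.span (e ` {..n})"
    proof (rule image_subsetI)
      fix f
      have "reweight f \<psi> = (\<Sum>k\<le>n. sc (f k) (e k))"
        unfolding e_def by (rule reweight_eq_sum [OF sector])
      also have "\<dots> \<in> state_space.span (e ` {..n})"
        by (intro state_space.span_sum state_space.span_scale state_space.span_base) simp
      finally show "reweight f \<psi> \<in> state_space.span (e ` {..n})" .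
    qed
    show "state_space.independent (e ` {..n})"
      by (rule independent)
    show "card (e ` {..n}) = n + 1"
      by (simp add: card_image [OF inj])
  qed
  then show ?thesis
    by (simp add: cdim_eq_dim)
qed

context flat_band_hubbard
begin

lemma ground_space_eq: "ground_space d L t lam U U' (L ^ d) = range (\<lambda>f. reweight f (polarized d L lam))"
proof -
  have "polarized d L lam \<noteq> 0"
    using polarized_config_nonzero [of d L lam "{}"] by auto
  then show ?thesis
    using ground_space_eq_frustration_free [OF polarized_frustration_free polarized_in_sector]
      frustration_free_sector_eq by simp
qed

lemma spin_sq_ground_space:
  assumes "\<psi> \<in> ground_space d L t lam U U' (L ^ d)"
  shows "spin_sq d L \<psi> = sc (of_real ((real (L ^ d) / 2) * (real (L ^ d) / 2 + 1))) \<psi>"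
  using assms spin_sq_reweight [OF polarized_in_sector spin_symmetric_polarized]
  by (auto simp: ground_space_eq)

lemma cdim_ground_space: "cdim (ground_space d L t lam U U' (L ^ d)) = L ^ d + 1"
proof -
  have "\<exists>S. downs S = k \<and> polarized d L lam S \<noteq> 0" if "k \<le> L ^ d" for k
  proof -
    obtain A where "A \<subseteq> verts d L" "card A = L ^ d - k"
      using obtain_subset_with_card_n [of "L ^ d - k" "verts d L"] by (auto simp: card_verts)
    then have "downs (config d L A) = k"
      using that by (simp add: downs_config)
    then show ?thesis
      using polarized_config_nonzero by blast
  qed
  then show ?thesis
    unfolding ground_space_eq by (rule cdim_reweight [OF polarized_in_sector])
qed

end

theorem theorem2p3:
  fixes d L :: nat and t lam U U' :: real
  assumes "d \<ge> 1" and "L \<ge> 4" and "even L"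
    and "t > 0" and "lam > 0" and "U > 0" and "U' > 0"
  shows "(\<forall>\<psi> \<in> ground_space d L t lam U U' (L ^ d).
            spin_sq d L \<psi> = sc (of_real ((real (L ^ d) / 2) * (real (L ^ d) / 2 + 1))) \<psi>)
       \<and> cdim (ground_space d L t lam U U' (L ^ d)) = L ^ d + 1"
proof -
  interpret flat_band_hubbard d L lam t U U'
    using assms by unfold_locales auto
  show ?thesis
    using spin_sq_ground_space cdim_ground_space by blast
qed

end
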